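(* Let $a<b$ be real numbers, $T=b-a$, $t\in(a,b)$ fixed, $n$ a positive integer. Let $$K(x)=\frac{\cos\frac{\pi(x-t)}{T}}{\sin^3\frac{\pi(x-t)}{T}},\qquad e_m(x)=e^{\mathrm{i}2m\pi x/T},\qquad f_m(x)=K(x)e_m(x).$$ Then for each $s\in\{0,1,2\}$, $$\widehat{T}^{(s)}_n[f_m]=I[f_m],\qquad m=0,\pm1,\ldots,\pm(n-1),$$ and hence $$\widehat{T}^{(s)}_n[f]=I[f]\quad\text{for } f(x)=\frac{\cos\frac{\pi(x-t)}{T}}{\sin^3\frac{\pi(x-t)}{T}}\,u(x)\quad\text{for all } u(x)=\sum_{m=-(n-1)}^{n-1}c_m e^{\mathrm{i}2m\pi x/T}$$ with arbitrary complex coefficients $c_m$.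
   Context: Let $f$ be a $T$-periodic function which is $C^\infty$ on $\mathbb{R}\setminus\{t+kT:\ k\in\mathbb{Z}\}$ and such that $g(x)=(x-t)^3f(x)$ (extended to $x=t$) is $C^\infty$ on $[a,b]$. $I[f]$ denotes the Hadamard Finite Part of $\int_a^b f(x)\,dx$, that is, $$I[f]=\lim_{\epsilon\to0+}\left[\int_a^{t-\epsilon}f(x)\,dx+\int_{t+\epsilon}^bf(x)\,dx-\frac{2g'(t)}{\epsilon}\right].$$ With $h=T/n$, the quadrature formulas are $$\widehat{T}^{(0)}_n[f]=h\sum_{j=1}^{n-1}f(t+jh)-\frac{\pi^2}{3}g'(t)h^{-1}+\frac16 g'''(t)h,$$ $$\widehat{T}^{(1)}_n[f]=h\sum_{j=1}^{n}f(t+jh-h/2)-\pi^2g'(t)h^{-1},$$ $$\widehat{T}^{(2)}_n[f]=2h\sum_{j=1}^{n}f(t+jh-h/2)-\frac h2\sum_{j=1}^{2n}f(t+jh/2-h/4).$$ *)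

theory Defs
  imports "HOL-Analysis.Analysis"
begin

(* The function g(x) = (x - t)^3 f(x), extended to x = t by its limit there. *)
definition cubed_reg :: "real \<Rightarrow> (real \<Rightarrow> complex) \<Rightarrow> real \<Rightarrow> complex" where
  "cubed_reg t f x =
     (if x = t then Lim (at t) (\<lambda>y. of_real ((y - t) ^ 3) * f y)
      else of_real ((x - t) ^ 3) * f x)"

(* Iterated derivative of a complex-valued function of a real variable. *)
definition nth_vderiv :: "nat \<Rightarrow> (real \<Rightarrow> complex) \<Rightarrow> real \<Rightarrow> complex" where
  "nth_vderiv k = (\<lambda>g x. vector_derivative g (at x)) ^^ k"

(* The Hadamard finite part I[f] over [a,b], singular at t, exists and equals I: the integrals
   over the punctured interval exist for all small eps > 0, and the limit defining I[f] is I. *)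
definition has_hadamard_fp ::
  "real \<Rightarrow> real \<Rightarrow> real \<Rightarrow> (real \<Rightarrow> complex) \<Rightarrow> complex \<Rightarrow> bool" where
  "has_hadamard_fp a b t f I \<longleftrightarrow>
     (\<forall>\<^sub>F eps in at_right 0. f integrable_on {a..t - eps} \<and> f integrable_on {t + eps..b}) \<and>
     ((\<lambda>eps. integral {a..t - eps} f + integral {t + eps..b} f
              - 2 * nth_vderiv 1 (cubed_reg t f) t / of_real eps) \<longlongrightarrow> I) (at_right 0)"

definition quad0 :: "real \<Rightarrow> real \<Rightarrow> nat \<Rightarrow> (real \<Rightarrow> complex) \<Rightarrow> complex" where
  "quad0 T t n f = (let h = T / real n; g = cubed_reg t f in
     of_real h * (\<Sum>j=1..n - 1. f (t + real j * h))
     - of_real (pi\<^sup>2 / 3) * nth_vderiv 1 g t / of_real h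
     + 1 / 6 * nth_vderiv 3 g t * of_real h)"

definition quad1 :: "real \<Rightarrow> real \<Rightarrow> nat \<Rightarrow> (real \<Rightarrow> complex) \<Rightarrow> complex" where
  "quad1 T t n f = (let h = T / real n; g = cubed_reg t f in
     of_real h * (\<Sum>j=1..n. f (t + real j * h - h / 2))
     - of_real (pi\<^sup>2) * nth_vderiv 1 g t / of_real h)"

definition quad2 :: "real \<Rightarrow> real \<Rightarrow> nat \<Rightarrow> (real \<Rightarrow> complex) \<Rightarrow> complex" where
  "quad2 T t n f = (let h = T / real n in
     2 * of_real h * (\<Sum>j=1..n. f (t + real j * h - h / 2))
     - of_real (h / 2) * (\<Sum>j=1..2 * n. f (t + real j * h / 2 - h / 4)))"

definition kern :: "real \<Rightarrow> real \<Rightarrow> real \<Rightarrow> real" where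
  "kern T t x = cos (pi * (x - t) / T) / sin (pi * (x - t) / T) ^ 3"

definition expo :: "real \<Rightarrow> int \<Rightarrow> real \<Rightarrow> complex" where
  "expo T m x = exp (\<i> * of_real (2 * of_int m * pi * x / T))"

end

theory Submission
  imports Defs "HOL-Real_Asymp.Real_Asymp"
begin

text \<open>
  Put \<open>\<theta> = \<pi> (x - t) / T\<close>. Up to the factor \<open>e\<^sub>m(t)\<close>, the function \<open>f\<^sub>m\<close> is
  \<open>cos \<theta> / sin\<^sup>3 \<theta>\<close> times \<open>cos (2 m \<theta>) + \<i> sin (2 m \<theta>)\<close>. The cosine part is odd about \<open>t\<close> and
  \<open>T\<close>-periodic, so it contributes neither to the finite part nor to the sums. For the sine part,
  taking second differences in \<open>m\<close> gives
  \<open>cos \<theta> sin (2 m \<theta>) / sin\<^sup>3 \<theta> = 2 m / sin\<^sup>2 \<theta> - 2 m\<^sup>2 - 4 \<Sum>\<^sub>0\<^sub><\<^sub>k\<^sub><\<^sub>m (m - k)\<^sup>2 cos (2 k \<theta>)\<close> for \<open>m > 0\<close>,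
  whose finite part is \<open>- 2 m\<^sup>2 T\<close>, and which can be summed over the nodes in closed form.
  The function \<open>w\<^sup>3 cos (c w) / sin\<^sup>3 (c w)\<close> with \<open>c = \<pi> / T\<close> is \<open>c\<^sup>-\<^sup>3 + O(w\<^sup>4)\<close>, so the derivative corrections
  in the quadrature formulas see only the derivatives of the trigonometric polynomial.
\<close>

section \<open>Derivatives at the singular point, read off power series\<close>

text \<open>Near \<open>t\<close> the derivative of \<open>g\<close> is again given by a power
  series, that of \<open>fps_deriv F\<close>, so the induction generalises over \<open>g\<close> and
  \<open>F\<close>. The agreement is assumed on a neighbourhood because it must survive
  differentiation.\<close>

lemma nth_vderiv_eval_fps:
  fixes F :: "complex fps" and g :: "real \<Rightarrow> complex"
  assumes "0 < fps_conv_radius F"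
    and "\<forall>\<^sub>F x in nhds t. g x = eval_fps F (of_real (x - t))"
  shows "nth_vderiv k g t = fact k * fps_nth F k"
  using assms
proof (induction k arbitrary: g F)
  case 0
  then show ?case
    by (auto simp: nth_vderiv_def eval_fps_at_0 dest: eventually_nhds_x_imp_x)
next
  case (Suc k)
  let ?g' = "\<lambda>x. vector_derivative g (at x)"
  let ?R = "fps_conv_radius F"
  have "\<forall>\<^sub>F w in nhds (0::complex). w \<in> eball 0 ?R"
    using Suc.prems(1) by (intro eventually_nhds_in_open) (auto simp: zero_ereal_def)
  moreover have "((\<lambda>x. complex_of_real (x - t)) \<longlongrightarrow> 0) (nhds t)"
    by (auto intro!: tendsto_eq_intros filterlim_ident)
  ultimately have "\<forall>\<^sub>F x in nhds t. complex_of_real (x - t) \<in> eball 0 ?R"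
    unfolding filterlim_iff by blast
  \<comment> \<open>The derivative at \<open>x\<close> depends on values near \<open>x\<close>, so
    the agreement is needed around every \<open>x\<close> near \<open>t\<close>, not only at
    \<open>x\<close>.\<close>
  moreover have "\<forall>\<^sub>F x in nhds t. \<forall>\<^sub>F y in nhds x. g y = eval_fps F (of_real (y - t))"
    using Suc.prems(2) by (simp add: eventually_eventually)
  ultimately have "\<forall>\<^sub>F x in nhds t. ?g' x = eval_fps (fps_deriv F) (of_real (x - t))"
  proof eventually_elim
    case (elim x)
    have "((\<lambda>y. eval_fps F (of_real (y - t))) has_vector_derivative
        1 * eval_fps (fps_deriv F) (of_real (x - t))) (at x)"
      using elim
      by (intro field_vector_diff_chain_at[unfolded o_def] has_field_derivative_eval_fps)
        (auto intro!: derivative_eq_intros)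
    then have "(g has_vector_derivative eval_fps (fps_deriv F) (of_real (x - t))) (at x)"
      using elim by (subst has_vector_derivative_cong_ev[where g = "\<lambda>y. eval_fps F (of_real (y - t))"])
        (auto elim: eventually_mono dest: eventually_nhds_x_imp_x)
    then show ?case by (rule vector_derivative_at)
  qed
  moreover have "0 < fps_conv_radius (fps_deriv F)"
    using Suc.prems(1) fps_conv_radius_deriv[of F] by (rule less_le_trans)
  ultimately have "nth_vderiv k ?g' t = fact k * fps_nth (fps_deriv F) k"
    by (intro Suc.IH)
  then show ?case
    by (simp add: nth_vderiv_def funpow_Suc_right o_def algebra_simps del: funpow.simps)
qed

text \<open>In \<open>w = x - t\<close> the regularised function is \<open>U w\<close> times the
  even function \<open>cos (c w) / (sin (c w) / w)^3\<close>, whose expansion is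
  \<open>1 / c^3\<close> up to order 3. Orders 1 and 3 of the product are therefore those of
  \<open>E\<close> divided by \<open>c^3\<close>. The factor \<open>u\<close> is given through a
  complex function \<open>U\<close> because \<open>has_fps_expansion\<close> needs equal argument
  and value types.\<close>

lemma nth_vderiv_cubed_reg:
  fixes E :: "complex fps" and u :: "real \<Rightarrow> complex"
  assumes T: "T \<noteq> 0"
    and U: "U has_fps_expansion E" and u: "\<And>x. u x = U (of_real (x - t))"
  defines "c \<equiv> complex_of_real (pi / T)"
  shows "nth_vderiv 1 (cubed_reg t (\<lambda>x. of_real (kern T t x) * u x)) t = fps_nth E 1 / c ^ 3"
    and "nth_vderiv 3 (cubed_reg t (\<lambda>x. of_real (kern T t x) * u x)) t = 6 * fps_nth E 3 / c ^ 3"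
proof -
  let ?f = "\<lambda>x. of_real (kern T t x) * u x"
  have c: "c \<noteq> 0" using T by (simp add: c_def)
  \<comment> \<open>The quotient \<open>sin (c w) / w\<close> with its removable singularity filled;
    the exponent 1 matches the form of \<open>has_fps_expansion_shift\<close>.\<close>
  define s where "s = (\<lambda>w. if w = 0 then c else sin (c * w) / w ^ 1)"
  define S where "S = fps_shift 1 (fps_sin c)"
  have s: "s has_fps_expansion S"
    unfolding s_def S_def
    by (rule has_fps_expansion_shift[OF has_fps_expansion_sin])
      (use c in \<open>auto simp: fps_sin_def intro!: subdegree_geI dest: arg_cong[of _ _ "\<lambda>F. fps_nth F 1"]\<close>)
  have S: "fps_nth S 0 = c" "fps_nth S 1 = 0" "fps_nth S 2 = - (c ^ 3 / 6)" "fps_nth S 3 = 0"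
    by (auto simp: S_def fps_sin_def fact_numeral)
  define K where "K = fps_cos c / (S * S * S)"
  have K': "(\<lambda>w. cos (c * w) / (s w * s w * s w)) has_fps_expansion K"
    unfolding K_def using S c by (intro has_fps_expansion_divide' has_fps_expansion_cos has_fps_expansion_mult s) auto
  have "K * (S * S * S) = fps_cos c"
    unfolding K_def using S c by (simp add: fps_divide_unit inverse_mult_eq_1 mult.assoc)
  then have KS: "fps_nth (K * (S * S * S)) i = fps_nth (fps_cos c) i" for i by simp
  \<comment> \<open>Coefficients are compared order by order in \<open>K * S^3 = fps_cos c\<close>.
    At order 2 the contribution of \<open>fps_nth K 0\<close> is already \<open>- c^2 / 2\<close>,
    the coefficient of the cosine, which forces \<open>fps_nth K 2 = 0\<close>.\<close>
  have K: "fps_nth K 0 = 1 / c ^ 3" "fps_nth K 1 = 0" "fps_nth K 2 = 0" "fps_nth K 3 = 0"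
  proof -
    define P where "P = S * S * S"
    have P: "fps_nth P 0 = c ^ 3" "fps_nth P 1 = 0" "fps_nth P 2 = - (c ^ 5 / 2)" "fps_nth P 3 = 0"
      using S by (simp_all add: P_def fps_mult_nth eval_nat_numeral field_simps)
    note KP = KS[folded P_def]
    show K0: "fps_nth K 0 = 1 / c ^ 3"
      using KP[of 0] P c by (simp add: fps_mult_nth fps_cos_def field_simps)
    show K1: "fps_nth K 1 = 0"
      using KP[of 1] P c K0 by (simp add: fps_mult_nth fps_cos_def)
    show K2: "fps_nth K 2 = 0"
      using KP[of 2] P c K0 K1 by (simp add: fps_mult_nth fps_cos_def numeral_2_eq_2 field_simps flip: power_Suc power_add)
    have "fps_nth (fps_cos c) 3 = 0" by (simp add: fps_cos_def)
    then show "fps_nth K 3 = 0"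
      using KP[of 3] P c K0 K1 K2 by (simp add: fps_mult_nth numeral_3_eq_3 numeral_2_eq_2)
  qed
  have F: "(\<lambda>w. cos (c * w) / (s w * s w * s w) * U w) has_fps_expansion K * E" (is "?H has_fps_expansion ?F")
    by (intro has_fps_expansion_mult K' U)
  have H: "of_real ((x - t) ^ 3) * ?f x = ?H (of_real (x - t))" if "x \<noteq> t" for x
  proof -
    have "c * of_real (x - t) = of_real (pi * (x - t) / T)" by (simp add: c_def)
    then have "sin (c * of_real (x - t)) = of_real (sin (pi * (x - t) / T))"
      "cos (c * of_real (x - t)) = of_real (cos (pi * (x - t) / T))"
      by (simp_all only: sin_of_real cos_of_real)
    with that show ?thesis
      by (simp add: s_def kern_def u power3_eq_cube del: of_real_diff)
  qed
  \<comment> \<open>Continuity identifies the limit by which \<open>cubed_reg\<close> is extended to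
    \<open>t\<close> as \<open>?H 0\<close>, so one formula covers all \<open>x\<close>.\<close>
  have "isCont ?H 0" using F by (rule has_fps_expansion_imp_continuous)
  then have "((\<lambda>x. ?H (of_real (x - t))) \<longlongrightarrow> ?H 0) (at t)"
    by (intro isCont_tendsto_compose[where g = ?H]) (auto intro!: tendsto_eq_intros)
  then have "((\<lambda>x. of_real ((x - t) ^ 3) * ?f x) \<longlongrightarrow> ?H 0) (at t)"
    by (rule Lim_transform_eventually) (use H in \<open>auto simp: eventually_at_filter\<close>)
  then have "cubed_reg t ?f x = ?H (of_real (x - t))" for x
    using H[of x] by (auto simp: cubed_reg_def intro!: tendsto_Lim)
  moreover have "\<forall>\<^sub>F x in nhds t. ?H (of_real (x - t)) = eval_fps ?F (of_real (x - t))"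
  proof -
    have "\<forall>\<^sub>F w in nhds 0. ?H w = eval_fps ?F w"
      using F by (auto simp: has_fps_expansion_def eq_commute)
    moreover have "((\<lambda>x. complex_of_real (x - t)) \<longlongrightarrow> 0) (nhds t)"
      by (auto intro!: tendsto_eq_intros filterlim_ident)
    ultimately show ?thesis unfolding filterlim_iff by blast
  qed
  ultimately have "nth_vderiv k (cubed_reg t ?f) t = fact k * fps_nth ?F k" for k
    using F by (intro nth_vderiv_eval_fps) (auto simp: has_fps_expansion_def)
  then show "nth_vderiv 1 (cubed_reg t ?f) t = fps_nth E 1 / c ^ 3"
    "nth_vderiv 3 (cubed_reg t ?f) t = 6 * fps_nth E 3 / c ^ 3"
    using K by (simp_all add: fps_mult_nth numeral_3_eq_3 numeral_2_eq_2)
qed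

section \<open>Trigonometric identities: equally spaced cosine sums and the expansion of the sine
  part\<close>

text \<open>After multiplication by \<open>sin \<alpha>\<close> each term is half a difference of
  sines and the sum telescopes; this form also covers \<open>sin \<alpha> = 0\<close>.\<close>

lemma sum_cos_arith_progression:
  fixes \<alpha> \<beta> :: real
  shows "sin \<alpha> * (\<Sum>j<n. cos (\<beta> + 2 * real j * \<alpha>)) = sin (real n * \<alpha>) * cos (\<beta> + (real n - 1) * \<alpha>)"
proof (induction n)
  case (Suc n)
  have "sin (real (Suc n) * \<alpha>) * cos (\<beta> + (real (Suc n) - 1) * \<alpha>)
      = sin (real n * \<alpha>) * cos (\<beta> + (real n - 1) * \<alpha>) + sin \<alpha> * cos (\<beta> + 2 * real n * \<alpha>)"
    using sin_minus[of "\<beta> + 2 * real n * \<alpha> - \<alpha>"]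
    unfolding sin_times_cos by (simp add: algebra_simps add_divide_distrib[symmetric])
  with Suc show ?case by (simp add: algebra_simps)
qed auto

lemma sum_cos_roots_eq_0:
  fixes \<beta> :: real
  assumes "0 < k" "k < n"
  shows "(\<Sum>j<n. cos (\<beta> + 2 * real j * (real k * pi / real n))) = 0"
proof -
  have "0 < sin (real k * pi / real n)"
    using assms by (intro sin_gt_zero) (auto simp: field_simps)
  moreover have "sin (real n * (real k * pi / real n)) = 0"
    using assms by simp
  ultimately show ?thesis
    using sum_cos_arith_progression[of "real k * pi / real n" \<beta> n] by simp
qed

text \<open>\<open>cot_coeff\<close> and \<open>kern_coeff\<close> are the cosine coefficients of \<open>cot x * sin (2 m x)\<close> and of the regular
  part of \<open>cos x * sin (2 m x) / sin x ^ 3\<close>. The natural subtraction truncates, so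
  \<open>kern_coeff m k = 0\<close> for \<open>k \<ge> m\<close>.\<close>

definition cot_coeff :: "nat \<Rightarrow> nat \<Rightarrow> real" where
  "cot_coeff m k = (if m < k then 0 else if k = 0 \<or> k = m then 1 else 2)"

definition kern_coeff :: "nat \<Rightarrow> nat \<Rightarrow> real" where
  "kern_coeff m k = (if k = 0 then - 2 else - 4) * real (m - k) ^ 2"

definition kern_poly :: "nat \<Rightarrow> real \<Rightarrow> real" where
  "kern_poly m x = (\<Sum>k<m. kern_coeff m k * cos (2 * real k * x))"

text \<open>Passing from \<open>m\<close> to \<open>m + 1\<close> adds
  \<open>cos (2 m x) + cos (2 (m + 1) x)\<close>: the old end coefficient rises from 1 to 2 and a
  new end coefficient 1 appears. The case \<open>m = 0\<close> is excluded because
  \<open>cot_coeff 0 0 = 1\<close>.\<close>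

lemma cos_mult_sin_expand:
  assumes "0 < m"
  shows "cos x * sin (2 * real m * x) = sin x * (\<Sum>k\<le>m. cot_coeff m k * cos (2 * real k * x))"
  using assms
proof (induction m rule: nat_induct_non_zero)
  case 1
  have "sin (2 * x) = 2 * sin x * cos x" by (rule sin_double)
  moreover have "cos (2 * x) = 2 * cos x ^ 2 - 1" by (rule cos_double_cos)
  ultimately show ?case
    by (simp add: cot_coeff_def power2_eq_square algebra_simps)
next
  case (Suc m)
  have 1: "(\<Sum>k\<le>Suc m. cot_coeff (Suc m) k * cos (2 * real k * x))
      = (\<Sum>k\<le>m. cot_coeff m k * cos (2 * real k * x)) + cos (2 * real m * x) + cos (2 * real (Suc m) * x)"
  proof -
    have "{..m} = insert m {..<m}" "{..Suc m} = insert (Suc m) (insert m {..<m})" by auto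
    moreover have "(\<Sum>k<m. cot_coeff (Suc m) k * cos (2 * real k * x)) = (\<Sum>k<m. cot_coeff m k * cos (2 * real k * x))"
      by (intro sum.cong) (auto simp: cot_coeff_def)
    ultimately show ?thesis using Suc by (simp add: cot_coeff_def)
  qed
  have "cos x * (sin (2 * real (Suc m) * x) - sin (2 * real m * x))
      = sin x * (cos (2 * real m * x) + cos (2 * real (Suc m) * x))"
    unfolding sin_diff_sin cos_plus_cos by (simp add: algebra_simps add_divide_distrib)
  with Suc.IH show ?case unfolding 1 by (simp add: algebra_simps)
qed

lemma kern_poly_extend:
  assumes "m \<le> N"
  shows "kern_poly m x = (\<Sum>k<N. kern_coeff m k * cos (2 * real k * x))"
  unfolding kern_poly_def using assms
  by (intro sum.mono_neutral_left) (auto simp: kern_coeff_def)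

text \<open>The second difference of \<open>(m - k)^2\<close> in \<open>m\<close> is 2, which gives
  -8 for inner \<open>k\<close> and -4 for \<open>k = 0\<close>. At \<open>k = m + 1\<close>
  truncated subtraction leaves only the first term, -4, matching the end coefficient of the
  cotangent expansion.\<close>

lemma kern_coeff_rec:
  assumes "k \<le> Suc m"
  shows "kern_coeff (Suc (Suc m)) k - 2 * kern_coeff (Suc m) k + kern_coeff m k = - 4 * cot_coeff (Suc m) k"
proof (cases "k \<le> m")
  case True
  then show ?thesis 
    by (auto simp: kern_coeff_def cot_coeff_def of_nat_diff Suc_diff_le power2_eq_square algebra_simps)
next
  case False
  with assms have "k = Suc m" by simp
  then show ?thesis by (simp add: kern_coeff_def cot_coeff_def)
qed

lemma kern_poly_rec:
  "kern_poly (Suc (Suc m)) x - 2 * kern_poly (Suc m) x + kern_poly m x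
    = - 4 * (\<Sum>k\<le>Suc m. cot_coeff (Suc m) k * cos (2 * real k * x))"
proof -
  let ?N = "Suc (Suc m)"
  have "kern_poly (Suc (Suc m)) x - 2 * kern_poly (Suc m) x + kern_poly m x
    = (\<Sum>k<?N. (kern_coeff (Suc (Suc m)) k - 2 * kern_coeff (Suc m) k + kern_coeff m k) * cos (2 * real k * x))"
    \<comment> \<open>All three polynomials are brought to one index range; the added coefficients
      are 0.\<close>
    by (subst (1 2 3) kern_poly_extend[where N = ?N])
      (auto simp: sum.distrib sum_subtractf sum_distrib_left algebra_simps)
  also have "\<dots> = (\<Sum>k<?N. - 4 * (cot_coeff (Suc m) k * cos (2 * real k * x)))"
    by (intro sum.cong refl) (auto simp: kern_coeff_rec)
  also have "\<dots> = - 4 * (\<Sum>k\<le>Suc m. cot_coeff (Suc m) k * cos (2 * real k * x))"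
    by (simp only: sum_distrib_left lessThan_Suc_atMost)
  finally show ?thesis .
qed

text \<open>Both sides obey the same second-order recursion in \<open>m\<close>. On the left,
  \<open>cos (2 x) = 1 - 2 sin^2 x\<close> produces the extra term
  \<open>- 4 sin^2 x * cos x * sin (2 (m + 1) x)\<close>; by \<open>cos_mult_sin_expand\<close> this
  is \<open>sin^3 x\<close> times the second difference of \<open>kern_poly\<close>. Clearing
  denominators keeps the identity valid at zeros of the sine.\<close>

lemma kern_sin_expand:
  "cos x * sin (2 * real m * x) = 2 * real m * sin x + kern_poly m x * sin x ^ 3"
proof (induction m rule: less_induct)
  case (less m)
  consider "m = 0" | "m = 1" | l where "m = Suc (Suc l)"
    by (metis One_nat_def old.nat.exhaust)
  then show ?case
  proof cases
    case 1
    then show ?thesis by (simp add: kern_poly_def)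
  next
    case 2
    have "cos x * (2 * sin x * cos x) = 2 * sin x - 2 * sin x ^ 3"
      using sin_cos_squared_add[of x] by algebra
    with 2 show ?thesis 
      by (simp add: kern_poly_def kern_coeff_def sin_double)
  next
    case 3
    let ?D = "\<Sum>k\<le>Suc l. cot_coeff (Suc l) k * cos (2 * real k * x)"
    define s where "s k = sin (2 * real k * x)" for k
    have "s (Suc (Suc l)) + s l = 2 * s (Suc l) * cos (2 * x)"
      unfolding s_def sin_plus_sin by (simp add: algebra_simps add_divide_distrib)
    also have "cos (2 * x) = 1 - 2 * sin x ^ 2" by (rule cos_double_sin)
    finally have s: "s (Suc (Suc l)) = 2 * s (Suc l) - s l - 4 * sin x ^ 2 * s (Suc l)"
      by (simp add: algebra_simps)
    have D: "cos x * s (Suc l) = sin x * ?D"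
      unfolding s_def by (rule cos_mult_sin_expand) simp
    have P: "kern_poly (Suc (Suc l)) x = 2 * kern_poly (Suc l) x - kern_poly l x - 4 * ?D"
      using kern_poly_rec[of l x] by simp
    have IH: "cos x * s l = 2 * real l * sin x + kern_poly l x * sin x ^ 3"
      "cos x * s (Suc l) = 2 * real (Suc l) * sin x + kern_poly (Suc l) x * sin x ^ 3"
      using less[of l] less[of "Suc l"] 3 unfolding s_def by simp_all
    have "cos x * s (Suc (Suc l)) = 2 * (cos x * s (Suc l)) - cos x * s l - 4 * sin x ^ 2 * (cos x * s (Suc l))"
      unfolding s by (simp add: algebra_simps)
    also have "\<dots> = 2 * (2 * real (Suc l) * sin x + kern_poly (Suc l) x * sin x ^ 3)
        - (2 * real l * sin x + kern_poly l x * sin x ^ 3) - 4 * sin x ^ 2 * (sin x * ?D)"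
      using IH D by simp
    also have "\<dots> = 2 * real (Suc (Suc l)) * sin x + kern_poly (Suc (Suc l)) x * sin x ^ 3"
      unfolding P by (simp add: algebra_simps power2_eq_square power3_eq_cube)
    finally show ?thesis unfolding 3 s_def .
  qed
qed

text \<open>The recursion is evaluated at 0, where the cotangent coefficients sum to
  \<open>1 + 2 l + 1\<close>. The value is needed because the trapezoidal sum omits the node at
  0.\<close>

lemma kern_poly_0: "kern_poly m 0 = - (4 * real m ^ 3 + 2 * real m) / 3"
proof (induction m rule: less_induct)
  case (less m)
  consider "m = 0" | "m = 1" | l where "m = Suc (Suc l)"
    by (metis One_nat_def old.nat.exhaust)
  then show ?case
  proof cases
    case 3
    have "(\<Sum>k\<le>Suc l. cot_coeff (Suc l) k) = 2 * real (Suc l)"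
    proof -
      have "{..Suc l} = insert 0 (insert (Suc l) {1..l})" by auto
      moreover have "(\<Sum>k=1..l. cot_coeff (Suc l) k) = (\<Sum>k=1..l. 2)"
        by (intro sum.cong) (auto simp: cot_coeff_def)
      ultimately show ?thesis by (simp add: cot_coeff_def)
    qed
    then have "kern_poly (Suc (Suc l)) 0 = 2 * kern_poly (Suc l) 0 - kern_poly l 0 - 8 * real (Suc l)"
      using kern_poly_rec[of l 0] by simp
    with less[of l] less[of "Suc l"] 3 show ?thesis
      by (simp add: field_simps power3_eq_cube)
  qed (auto simp: kern_poly_def kern_coeff_def)
qed

section \<open>Sums of the sine part over trapezoidal and midpoint nodes\<close>

text \<open>Every frequency \<open>0 < k < n\<close> cancels over the nodes for any offset
  \<open>\<beta>\<close>, leaving the constant term \<open>- 2 m^2\<close>. The case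
  \<open>m = n\<close> is included, since the top frequency is \<open>m - 1\<close>; the cosecant
  sums rely on it.\<close>

lemma sum_kern_poly_nodes:
  assumes "0 < n" "m \<le> n"
  shows "(\<Sum>j<n. kern_poly m (\<beta> + real j * (pi / real n))) = - 2 * real m ^ 2 * real n"
proof -
  have "(\<Sum>j<n. kern_poly m (\<beta> + real j * (pi / real n)))
    = (\<Sum>k<m. kern_coeff m k * (\<Sum>j<n. cos (2 * real k * (\<beta> + real j * (pi / real n)))))"
    unfolding kern_poly_def by (subst sum.swap) (simp add: sum_distrib_left)
  also have "\<dots> = (\<Sum>k<m. if k = 0 then - 2 * real m ^ 2 * real n else 0)"
  proof (intro sum.cong refl)
    fix k assume "k \<in> {..<m}"
    then have "(\<Sum>j<n. cos (2 * real k * (\<beta> + real j * (pi / real n)))) = 0" if "k > 0"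
      using that assms sum_cos_roots_eq_0[of k n "2 * real k * \<beta>"] by (simp add: algebra_simps)
    then show "kern_coeff m k * (\<Sum>j<n. cos (2 * real k * (\<beta> + real j * (pi / real n))))
      = (if k = 0 then - 2 * real m ^ 2 * real n else 0)"
      by (auto simp: kern_coeff_def)
  qed
  also have "\<dots> = - 2 * real m ^ 2 * real n"
    using sum.delta[of "{..<m}" 0 "\<lambda>k. - 2 * real m ^ 2 * real n"] by (cases "m = 0") auto
  finally show ?thesis .
qed

lemma kern_sin_divide:
  assumes "sin x \<noteq> 0"
  shows "cos x / sin x ^ 3 * sin (2 * real m * x) = 2 * real m / sin x ^ 2 + kern_poly m x"
proof -
  have "cos x / sin x ^ 3 * sin (2 * real m * x) = (2 * real m * sin x + kern_poly m x * sin x ^ 3) / sin x ^ 3"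
    by (simp add: kern_sin_expand[symmetric])
  also have "\<dots> = 2 * real m / sin x ^ 2 + kern_poly m x"
    using assms by (simp add: add_divide_distrib power2_eq_square power3_eq_cube)
  finally show ?thesis .
qed

lemma trapezoid_node_sin_pos:
  assumes "j \<in> {1..n - 1}"
  shows "0 < sin (real j * (pi / real n))"
  using assms by (intro sin_gt_zero) (auto simp: field_simps)

lemma midpoint_node_sin_pos:
  assumes "j < n"
  shows "0 < sin (pi / (2 * real n) + real j * (pi / real n))"
proof (rule sin_gt_zero)
  have "2 * j + 1 < 2 * n" using assms by simp
  then have "2 * real j + 1 < 2 * real n" by linarith
  then have "pi * (2 * real j + 1) < pi * (2 * real n)" by simp
  then show "pi / (2 * real n) + real j * (pi / real n) < pi"
    using assms by (simp add: field_simps)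
  show "0 < pi / (2 * real n) + real j * (pi / real n)"
    using assms by (intro add_pos_nonneg) auto
qed

lemma sum_kern_poly_trapezoid:
  assumes "0 < n" "m \<le> n"
  shows "(\<Sum>j=1..n-1. kern_poly m (real j * (pi / real n)))
    = (4 * real m ^ 3 + 2 * real m) / 3 - 2 * real m ^ 2 * real n"
proof -
  have "{..<n} = insert 0 {1..n-1}" using assms by auto
  then show ?thesis
    using sum_kern_poly_nodes[OF assms, of 0] by (simp add: kern_poly_0 field_simps)
qed

text \<open>At the nodes \<open>sin (2 n x)\<close> vanishes, so \<open>kern_sin_divide\<close> with \<open>m = n\<close> expresses
  the cosecant sums by the sums of the trigonometric polynomial.\<close>

lemma sum_csc_sq_trapezoid:
  assumes "0 < n"
  shows "(\<Sum>j=1..n-1. 1 / sin (real j * (pi / real n)) ^ 2) = (real n ^ 2 - 1) / 3"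
proof -
  have "2 * real n * (1 / sin (real j * (pi / real n)) ^ 2) = - kern_poly n (real j * (pi / real n))"
    if "j \<in> {1..n - 1}" for j
  proof -
    have "sin (2 * real n * (real j * (pi / real n))) = sin (real (2 * j) * pi)"
      using assms by (simp add: field_simps)
    then have "sin (2 * real n * (real j * (pi / real n))) = 0" by (simp only: sin_npi)
    then show ?thesis
      using trapezoid_node_sin_pos[OF that] kern_sin_divide[of "real j * (pi / real n)" n] by simp
  qed
  then have "2 * real n * (\<Sum>j=1..n-1. 1 / sin (real j * (pi / real n)) ^ 2)
      = - (\<Sum>j=1..n-1. kern_poly n (real j * (pi / real n)))"
    unfolding sum_distrib_left sum_negf[symmetric] by (intro sum.cong) auto
  also have "\<dots> = 2 * real n * ((real n ^ 2 - 1) / 3)"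
    unfolding sum_kern_poly_trapezoid[OF assms order_refl]
    by (simp add: field_simps power2_eq_square power3_eq_cube)
  finally show ?thesis using assms by simp
qed

lemma sum_csc_sq_midpoint:
  assumes "0 < n"
  shows "(\<Sum>j<n. 1 / sin (pi / (2 * real n) + real j * (pi / real n)) ^ 2) = real n ^ 2"
proof -
  let ?x = "\<lambda>j. pi / (2 * real n) + real j * (pi / real n)"
  have "2 * real n * (1 / sin (?x j) ^ 2) = - kern_poly n (?x j)" if "j \<in> {..<n}" for j
  proof -
    have "2 * real n * ?x j = real (2 * j + 1) * pi"
      using assms by (simp add: field_simps)
    then have "sin (2 * real n * ?x j) = 0" by (simp only: sin_npi)
    then show ?thesis
      using that midpoint_node_sin_pos[of j n] kern_sin_divide[of "?x j" n] by simp
  qed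
  then have "2 * real n * (\<Sum>j<n. 1 / sin (?x j) ^ 2) = - (\<Sum>j<n. kern_poly n (?x j))"
    unfolding sum_distrib_left sum_negf[symmetric] by (intro sum.cong) auto
  also have "\<dots> = 2 * real n * real n ^ 2"
    unfolding sum_kern_poly_nodes[OF assms order_refl] by (simp add: power2_eq_square)
  finally show ?thesis using assms by simp
qed

text \<open>Both sides are odd in \<open>m\<close>, so negative \<open>m\<close> reduces to
  \<open>- m\<close> and \<open>sgn m\<close> carries the sign.\<close>

lemma kern_sin_divide_int:
  assumes "sin x \<noteq> 0"
  shows "cos x / sin x ^ 3 * sin (2 * real_of_int m * x)
    = 2 * real_of_int m / sin x ^ 2 + real_of_int (sgn m) * kern_poly (nat \<bar>m\<bar>) x"
proof (cases "0 \<le> m")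
  case True
  then show ?thesis using kern_sin_divide[OF assms, of "nat m"]
    by (cases "m = 0") (auto simp: kern_poly_def)
next
  case False
  then show ?thesis using kern_sin_divide[OF assms, of "nat (- m)"] by auto
qed

lemma sum_kern_sin_trapezoid:
  assumes "\<bar>m\<bar> < int n"
  shows "(\<Sum>j=1..n-1. cos (real j * (pi / real n)) / sin (real j * (pi / real n)) ^ 3
        * sin (2 * real_of_int m * (real j * (pi / real n))))
    = 2 * real_of_int m * (real n ^ 2 - 1) / 3 + (4 * real_of_int m ^ 3 + 2 * real_of_int m) / 3 - 2 * real_of_int m * \<bar>real_of_int m\<bar> * real n"
proof -
  let ?x = "\<lambda>j. real j * (pi / real n)"
  have n: "0 < n" "nat \<bar>m\<bar> \<le> n" using assms by auto
  have "(\<Sum>j=1..n-1. cos (?x j) / sin (?x j) ^ 3 * sin (2 * real_of_int m * ?x j))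
    = (\<Sum>j=1..n-1. 2 * real_of_int m * (1 / sin (?x j) ^ 2) + real_of_int (sgn m) * kern_poly (nat \<bar>m\<bar>) (?x j))"
    by (intro sum.cong refl, subst kern_sin_divide_int) (use trapezoid_node_sin_pos in force)+
  also have "\<dots> = 2 * real_of_int m * ((real n ^ 2 - 1) / 3)
      + real_of_int (sgn m) * ((4 * real (nat \<bar>m\<bar>) ^ 3 + 2 * real (nat \<bar>m\<bar>)) / 3 - 2 * real (nat \<bar>m\<bar>) ^ 2 * real n)"
    unfolding sum.distrib sum_distrib_left[symmetric] sum_csc_sq_trapezoid[OF n(1)] sum_kern_poly_trapezoid[OF n] ..
  \<comment> \<open>The signs are absorbed: \<open>sgn m * \<bar>m\<bar>^3 = m^3\<close>, whereas
    \<open>sgn m * \<bar>m\<bar>^2 = m * \<bar>m\<bar>\<close>.\<close>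
  also have "\<dots> = 2 * real_of_int m * (real n ^ 2 - 1) / 3 + (4 * real_of_int m ^ 3 + 2 * real_of_int m) / 3 - 2 * real_of_int m * \<bar>real_of_int m\<bar> * real n"
    by (cases "m > 0"; cases "m = 0") (auto simp: power2_eq_square power3_eq_cube field_simps)
  finally show ?thesis .
qed

lemma sum_kern_sin_midpoint:
  assumes "\<bar>m\<bar> < int n"
  defines "x \<equiv> \<lambda>j::nat. pi / (2 * real n) + real j * (pi / real n)"
  shows "(\<Sum>j<n. cos (x j) / sin (x j) ^ 3 * sin (2 * real_of_int m * x j))
    = 2 * real_of_int m * real n ^ 2 - 2 * real_of_int m * \<bar>real_of_int m\<bar> * real n"
proof -
  have n: "0 < n" "nat \<bar>m\<bar> \<le> n" using assms by auto
  have "(\<Sum>j<n. cos (x j) / sin (x j) ^ 3 * sin (2 * real_of_int m * x j))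
    = (\<Sum>j<n. 2 * real_of_int m * (1 / sin (x j) ^ 2) + real_of_int (sgn m) * kern_poly (nat \<bar>m\<bar>) (x j))"
    by (intro sum.cong refl, subst kern_sin_divide_int) (use midpoint_node_sin_pos in \<open>force simp: x_def\<close>)+
  also have "\<dots> = 2 * real_of_int m * real n ^ 2 + real_of_int (sgn m) * (- 2 * real (nat \<bar>m\<bar>) ^ 2 * real n)"
    unfolding sum.distrib sum_distrib_left[symmetric] x_def sum_csc_sq_midpoint[OF n(1)] sum_kern_poly_nodes[OF n] ..
  also have "\<dots> = 2 * real_of_int m * real n ^ 2 - 2 * real_of_int m * \<bar>real_of_int m\<bar> * real n"
    by (cases "m > 0"; cases "m = 0") (auto simp: power2_eq_square field_simps)
  finally show ?thesis .
qed

section \<open>Vanishing of the cosine part over the nodes\<close>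

text \<open>Reindexing by \<open>\<sigma>\<close> turns the sum into its own negative; a node at
  \<open>pi / 2\<close> may be paired with itself.\<close>

lemma sum_reflect_eq_0:
  fixes f :: "real \<Rightarrow> real" and x :: "nat \<Rightarrow> real"
  assumes "\<And>y. f (pi - y) = - f y"
    and "bij_betw \<sigma> A A" and "\<And>j. j \<in> A \<Longrightarrow> x (\<sigma> j) = pi - x j"
  shows "(\<Sum>j\<in>A. f (x j)) = 0"
proof -
  have "(\<Sum>j\<in>A. f (x j)) = (\<Sum>j\<in>A. f (x (\<sigma> j)))"
    using assms(2) by (rule sum.reindex_bij_betw[symmetric])
  also have "\<dots> = - (\<Sum>j\<in>A. f (x j))"
    using assms by (simp add: sum_negf)
  finally show ?thesis by simp
qed

lemma kern_cos_reflect: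
  "cos (pi - y) / sin (pi - y) ^ 3 * cos (2 * real_of_int m * (pi - y))
    = - (cos y / sin y ^ 3 * cos (2 * real_of_int m * y))"
proof -
  have "cos (2 * real_of_int m * (pi - y)) = cos (2 * real_of_int m * y)"
    using cos_int_2pin[of m] sin_int_2pin[of m] by (simp add: cos_diff algebra_simps)
  then show ?thesis by simp
qed

lemma sum_kern_cos_trapezoid:
  "(\<Sum>j=1..n-1. cos (real j * (pi / real n)) / sin (real j * (pi / real n)) ^ 3
        * cos (2 * real_of_int m * (real j * (pi / real n)))) = 0"
proof (rule sum_reflect_eq_0[where \<sigma> = "\<lambda>j. n - j" and x = "\<lambda>j. real j * (pi / real n)"])
  show "bij_betw (\<lambda>j. n - j) {1..n - 1} {1..n - 1}"
    by (rule bij_betw_byWitness[where f' = "\<lambda>j. n - j"]) auto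
qed (rule kern_cos_reflect, auto simp: of_nat_diff field_simps)

lemma sum_kern_cos_midpoint:
  defines "x \<equiv> \<lambda>n j::nat. pi / (2 * real n) + real j * (pi / real n)"
  shows "(\<Sum>j<n. cos (x n j) / sin (x n j) ^ 3 * cos (2 * real_of_int m * x n j)) = 0"
\<comment> \<open>Node \<open>j\<close> is \<open>(2 j + 1) pi / (2 n)\<close> with \<open>j\<close>
  starting at 0, so its mirror image has index \<open>n - 1 - j\<close>.\<close>
proof (rule sum_reflect_eq_0[where \<sigma> = "\<lambda>j. n - 1 - j" and x = "x n"])
  show "bij_betw (\<lambda>j. n - 1 - j) {..<n} {..<n}"
    by (rule bij_betw_byWitness[where f' = "\<lambda>j. n - 1 - j"]) auto
qed (rule kern_cos_reflect, auto simp: x_def of_nat_diff field_simps)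

section \<open>Finite part of the sine part\<close>

abbreviation kern_cos :: "int \<Rightarrow> real \<Rightarrow> real" where
  "kern_cos m x \<equiv> cos x / sin x ^ 3 * cos (2 * real_of_int m * x)"

abbreviation kern_sin :: "int \<Rightarrow> real \<Rightarrow> real" where
  "kern_sin m x \<equiv> cos x / sin x ^ 3 * sin (2 * real_of_int m * x)"

definition kern_poly_integral :: "nat \<Rightarrow> real \<Rightarrow> real" where
  "kern_poly_integral m x =
     (\<Sum>k<m. kern_coeff m k * (if k = 0 then x else sin (2 * real k * x) / (2 * real k)))"

lemma kern_poly_integral_deriv [derivative_intros]:
  assumes "(f has_field_derivative f') (at x within A)"
  shows "((\<lambda>x. kern_poly_integral m (f x)) has_field_derivative kern_poly m (f x) * f') (at x within A)"
proof -
  have "((\<lambda>x. kern_coeff m k * (if k = 0 then x else sin (2 * real k * x) / (2 * real k)))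
      has_field_derivative kern_coeff m k * cos (2 * real k * x)) (at x)" for k and x
    by (cases "k = 0") (auto intro!: derivative_eq_intros)
  then have "(kern_poly_integral m has_field_derivative kern_poly m x) (at x)" for x
    unfolding kern_poly_integral_def kern_poly_def by (intro DERIV_sum)
  from DERIV_chain2[OF this assms] show ?thesis .
qed

text \<open>The sine terms have period \<open>pi\<close>; only the linear term, from
  \<open>k = 0\<close>, grows. This growth becomes the value of the finite part.\<close>

lemma kern_poly_integral_add_pi:
  "kern_poly_integral m (x + pi) = kern_poly_integral m x - 2 * real m ^ 2 * pi"
proof -
  have "kern_poly_integral m (x + pi) - kern_poly_integral m x
    = (\<Sum>k<m. if k = 0 then - 2 * real m ^ 2 * pi else 0)"
    unfolding kern_poly_integral_def sum_subtractf[symmetric]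
  proof (intro sum.cong refl)
    fix k
    have "sin (2 * real k * (x + pi)) = sin (2 * real k * x)"
      using sin_npi[of "2 * k"] cos_npi[of "2 * k"] 
      by (simp add: sin_add distrib_left mult.assoc)
    then show "kern_coeff m k * (if k = 0 then x + pi else sin (2 * real k * (x + pi)) / (2 * real k))
        - kern_coeff m k * (if k = 0 then x else sin (2 * real k * x) / (2 * real k))
      = (if k = 0 then - 2 * real m ^ 2 * pi else 0)"
      by (auto simp: kern_coeff_def algebra_simps)
  qed
  also have "\<dots> = - 2 * real m ^ 2 * pi"
    using sum.delta[of "{..<m}" 0 "\<lambda>k. - 2 * real m ^ 2 * pi"] by (cases "m = 0") auto
  finally show ?thesis by simp
qed

lemma phase_sin_nonzero:
  fixes T t x :: real
  assumes "0 < T" "\<bar>x - t\<bar> < T" "x \<noteq> t"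
  shows "sin (pi * (x - t) / T) \<noteq> 0"
proof
  assume "sin (pi * (x - t) / T) = 0"
  moreover have "- pi < pi * (x - t) / T" "pi * (x - t) / T < pi"
  proof -
    define r where "r = (x - t) / T"
    have "- 1 < r" "r < 1" using assms by (auto simp: r_def field_simps)
    then have "pi * - 1 < pi * r" "pi * r < pi * 1"
      by (simp_all only: mult_less_cancel_left_pos[OF pi_gt_zero])
    then show "- pi < pi * (x - t) / T" "pi * (x - t) / T < pi"
      unfolding r_def by simp_all
  qed
  ultimately have "pi * (x - t) / T = 0" using sin_eq_0_pi by blast
  with assms show False by simp
qed

text \<open>An explicit antiderivative reduces the claim to its increment over \<open>[a, b]\<close>
  and its jump across \<open>t\<close>. The subtracted term cancels the pole of the cotangent. The
  integrals are returned as functions of \<open>e\<close> so that complex combinations can be formed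
  from them.\<close>

lemma kern_sin_finite_part:
  fixes a b t T :: real and m :: int
  assumes t: "a < t" "t < b" and T: "T = b - a"
  defines "f \<equiv> \<lambda>x. kern_sin m (pi * (x - t) / T)"
  shows "\<exists>A B. (\<forall>\<^sub>F e in at_right 0. (f has_integral A e) {a..t - e} \<and> (f has_integral B e) {t + e..b})
    \<and> ((\<lambda>e. A e + B e - 4 * real_of_int m * (T / pi) ^ 2 / e)
        \<longlongrightarrow> - 2 * real_of_int m * \<bar>real_of_int m\<bar> * T) (at_right 0)"
proof -
  have T0: "0 < T" using t T by simp
  \<comment> \<open>Termwise antiderivative of the right side of
    \<open>kern_sin_divide_int\<close>.\<close>
  define G where "G y = - 2 * real_of_int m * (cos y / sin y)
      + real_of_int (sgn m) * kern_poly_integral (nat \<bar>m\<bar>) y" for y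
  define F where "F x = T / pi * G (pi * (x - t) / T)" for x
  have G: "(G has_field_derivative kern_sin m y) (at y)" if "sin y \<noteq> 0" for y
  proof -
    have "((\<lambda>y. cos y / sin y) has_field_derivative
        (- sin y * sin y - cos y * cos y) / (sin y * sin y)) (at y)"
      by (rule DERIV_divide) (use that in \<open>auto intro!: derivative_eq_intros\<close>)
    also have "(- sin y * sin y - cos y * cos y) / (sin y * sin y) = - (1 / sin y ^ 2)"
      using sin_cos_squared_add[of y] by (simp add: power2_eq_square divide_simps; algebra)
    finally have "((\<lambda>y. cos y / sin y) has_field_derivative - (1 / sin y ^ 2)) (at y)" .
    from DERIV_add[OF DERIV_cmult[OF this, of "- 2 * real_of_int m"]
        DERIV_cmult[OF kern_poly_integral_deriv[OF DERIV_ident], of "real_of_int (sgn m)" "nat \<bar>m\<bar>"]]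
    show ?thesis unfolding G_def kern_sin_divide_int[OF that] by simp
  qed
  have F: "(F has_vector_derivative f x) (at x within S)" if "a \<le> x" "x \<le> b" "x \<noteq> t" for x S
  proof -
    have "sin (pi * (x - t) / T) \<noteq> 0"
      using that t T by (intro phase_sin_nonzero) (auto simp: abs_if)
    then have "((\<lambda>x. G (pi * (x - t) / T)) has_field_derivative f x * (pi / T)) (at x)"
      unfolding f_def by (intro DERIV_chain2[OF G]) (auto intro!: derivative_eq_intros)
    then have "(F has_field_derivative T / pi * (f x * (pi / T))) (at x)"
      unfolding F_def by (intro DERIV_cmult)
    then show ?thesis
      using T0 by (auto simp: has_real_derivative_iff_has_vector_derivative intro: has_vector_derivative_at_within)
  qed
  define d where "d = min (t - a) (b - t)"
  have d: "\<forall>\<^sub>F e in at_right 0. e \<in> {0<..<d}"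
    using t by (intro eventually_at_right_real) (auto simp: d_def)
  have int: "(f has_integral F (t - e) - F a) {a..t - e} \<and> (f has_integral F b - F (t + e)) {t + e..b}"
    if "e \<in> {0<..<d}" for e
    using that t by (intro conjI fundamental_theorem_of_calculus F) (auto simp: d_def)
  \<comment> \<open>From \<open>a\<close> to \<open>b\<close> the phase advances by exactly
    \<open>pi\<close>; the cotangent returns to its value and only the polynomial part
    contributes.\<close>
  have Fab: "F b - F a = - 2 * real_of_int m * \<bar>real_of_int m\<bar> * T"
  proof -
    have ph: "pi * (b - t) / T = pi * (a - t) / T + pi"
      using T0 unfolding T by (simp add: field_simps)
    have Gpi: "G (y + pi) - G y = - 2 * real_of_int m * \<bar>real_of_int m\<bar> * pi" for y
      unfolding G_def kern_poly_integral_add_pi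
      by (cases m "0::int" rule: linorder_cases) (simp_all add: power2_eq_square algebra_simps)
    have "F b - F a = T / pi * (G (pi * (a - t) / T + pi) - G (pi * (a - t) / T))"
      unfolding F_def ph by (rule right_diff_distrib[symmetric])
    also have "\<dots> = - 2 * real_of_int m * \<bar>real_of_int m\<bar> * T"
      unfolding Gpi by simp
    finally show ?thesis .
  qed
  \<comment> \<open>The jump across \<open>t\<close> is \<open>4 m (T / pi) cot (q e)\<close> up to
    a continuous difference tending to 0, and \<open>cot y - 1 / y\<close> tends to 0 with
    \<open>y\<close>.\<close>
  have "((\<lambda>e. F (t - e) - F (t + e) - 4 * real_of_int m * (T / pi) ^ 2 / e) \<longlongrightarrow> 0) (at_right 0)"
  proof -
    define q where "q = pi / T"
    have q: "0 < q" "T / pi = 1 / q" using T0 by (auto simp: q_def)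
    have "((\<lambda>x::real. cos x / sin x - 1 / x) \<longlongrightarrow> 0) (at_right 0)"
      by real_asymp
    moreover have "filterlim (\<lambda>e. q * e) (at_right 0) (at_right 0)"
      using q by real_asymp
    ultimately have "((\<lambda>e. cos (q * e) / sin (q * e) - 1 / (q * e)) \<longlongrightarrow> 0) (at_right 0)"
      by (rule filterlim_compose)
    moreover have "isCont (kern_poly_integral k) x" for k x
      by (rule DERIV_isCont[OF kern_poly_integral_deriv[OF DERIV_ident]])
    then have "((\<lambda>e. kern_poly_integral k (s * (q * e))) \<longlongrightarrow> kern_poly_integral k 0) (at_right 0)" for k s
      by (intro isCont_tendsto_compose[of 0 "kern_poly_integral k"]) (auto intro!: tendsto_eq_intros)
    ultimately have "((\<lambda>e. T / pi * (4 * real_of_int m * (cos (q * e) / sin (q * e) - 1 / (q * e))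
       + real_of_int (sgn m) * (kern_poly_integral (nat \<bar>m\<bar>) (- 1 * (q * e)) - kern_poly_integral (nat \<bar>m\<bar>) (1 * (q * e)))))
       \<longlongrightarrow> T / pi * (4 * real_of_int m * 0 + real_of_int (sgn m) * (kern_poly_integral (nat \<bar>m\<bar>) 0 - kern_poly_integral (nat \<bar>m\<bar>) 0))) (at_right 0)"
      by (intro tendsto_intros)
    moreover have "F (t - e) - F (t + e) - 4 * real_of_int m * (T / pi) ^ 2 / e
      = T / pi * (4 * real_of_int m * (cos (q * e) / sin (q * e) - 1 / (q * e))
       + real_of_int (sgn m) * (kern_poly_integral (nat \<bar>m\<bar>) (- 1 * (q * e)) - kern_poly_integral (nat \<bar>m\<bar>) (1 * (q * e))))" for e
    proof -
      have ph: "pi * (t - e - t) / T = - (q * e)" "pi * (t + e - t) / T = q * e"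
        by (simp_all add: q_def)
      show ?thesis unfolding F_def G_def ph q(2)
        using q(1) by (simp add: algebra_simps power2_eq_square)
    qed
    ultimately show ?thesis by simp
  qed
  then have "((\<lambda>e. F (t - e) - F (t + e) - 4 * real_of_int m * (T / pi) ^ 2 / e + (F b - F a))
      \<longlongrightarrow> 0 + (F b - F a)) (at_right 0)"
    by (intro tendsto_add tendsto_const)
  then have "((\<lambda>e. (F (t - e) - F a) + (F b - F (t + e)) - 4 * real_of_int m * (T / pi) ^ 2 / e)
      \<longlongrightarrow> - 2 * real_of_int m * \<bar>real_of_int m\<bar> * T) (at_right 0)"
    by (simp only: Fab[symmetric]) (simp add: algebra_simps)
  note lim = this
  have ev: "\<forall>\<^sub>F e in at_right 0.
      (f has_integral F (t - e) - F a) {a..t - e} \<and> (f has_integral F b - F (t + e)) {t + e..b}"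
    using d by eventually_elim (rule int)
  show ?thesis
    by (rule exI[of _ "\<lambda>e. F (t - e) - F a"], rule exI[of _ "\<lambda>e. F b - F (t + e)"])
      (rule conjI[OF ev lim])
qed

section \<open>Cancellation of the cosine part in the punctured integrals\<close>

text \<open>Since \<open>t\<close> need not be the midpoint, oddness alone does not suffice. With
  periodicity, \<open>f\<close> is also odd about \<open>t + T / 2\<close>, so an antiderivative is
  symmetric about that point and takes equal values at \<open>b\<close> and at
  \<open>2 * t - a\<close>, the mirror image of \<open>a\<close> in \<open>t\<close>.\<close>

lemma odd_periodic_punctured_integral:
  fixes f :: "real \<Rightarrow> real"
  assumes e: "0 < e" "e \<le> t - a" "e \<le> b - t" and T: "T = b - a"
    and cont: "\<And>x. 0 < \<bar>x - t\<bar> \<Longrightarrow> \<bar>x - t\<bar> < T \<Longrightarrow> isCont f x"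
    and odd: "\<And>y. f (t - y) = - f (t + y)" and per: "\<And>x. f (x + T) = f x"
  obtains A where "(f has_integral A) {a..t - e}" "(f has_integral - A) {t + e..b}"
proof -
  \<comment> \<open>A full punctured period to the right of \<open>t\<close>, since
    \<open>2 * t - a\<close> may lie beyond \<open>b\<close>.\<close>
  define J where "J = {t + e..t + T - e}"
  have "continuous_on J f"
    unfolding J_def using e T by (intro continuous_at_imp_continuous_on ballI cont) auto
  then obtain F where F: "\<And>x. x \<in> J \<Longrightarrow> (F has_vector_derivative f x) (at x within J)"
    unfolding J_def using antiderivative_continuous by blast
  \<comment> \<open>Reflection in \<open>t + T / 2\<close>, which is the fixed point used below to
    find \<open>k = 0\<close>.\<close>
  define R where "R x = 2 * t + T - x" for x :: real
  have R: "R x \<in> J" if "x \<in> J" for x using that by (auto simp: J_def R_def)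
  have fR: "f (R x) = - f x" for x
    using odd[of "t + T - x"] per[of "x - T"] odd[of "x - t"]  per[of "2 * t - x"]
    by (simp add: R_def algebra_simps)
  have "((\<lambda>x. F (R x) - F x) has_vector_derivative 0) (at x within J)" if "x \<in> J" for x
  proof -
    have "(F has_vector_derivative f (R x)) (at (R x) within R ` J)"
      using F[OF R[OF that]] by (rule has_vector_derivative_within_subset) (use R in auto)
    moreover have "(R has_vector_derivative - 1) (at x within J)"
      unfolding R_def by (auto intro!: derivative_eq_intros)
    ultimately have "((F \<circ> R) has_vector_derivative - 1 *\<^sub>R f (R x)) (at x within J)"
      by (intro vector_diff_chain_within)
    from has_vector_derivative_diff[OF this F[OF that]] show ?thesis
      by (simp add: fR o_def)
  qed
  moreover have "convex J" by (simp add: J_def)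
  ultimately obtain k where k: "\<And>x. x \<in> J \<Longrightarrow> F (R x) - F x = k"
    using has_vector_derivative_zero_constant[of J "\<lambda>x. F (R x) - F x"] by blast
  have "t + T / 2 \<in> J" using e T by (auto simp: J_def)
  then have "k = 0" using k[of "t + T / 2"] by (simp add: R_def)
  have "2 * t - a \<in> J" "R (2 * t - a) = b" using e T by (auto simp: J_def R_def)
  with k \<open>k = 0\<close> have Fb: "F b = F (2 * t - a)" by force
  have "(f has_integral F b - F (t + e)) {t + e..b}"
    using e T by (intro fundamental_theorem_of_calculus has_vector_derivative_within_subset[OF F])
      (auto simp: J_def)
  moreover have "(f has_integral F (2 * t - (t - e)) - F (2 * t - a)) {a..t - e}"
  proof (rule fundamental_theorem_of_calculus)
    fix x assume x: "x \<in> {a..t - e}"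
    then have "2 * t - x \<in> J" using e T by (auto simp: J_def)
    then have "(F has_vector_derivative f (2 * t - x)) (at (2 * t - x) within (\<lambda>x. 2 * t - x) ` {a..t - e})"
      by (rule has_vector_derivative_within_subset[OF F]) (use e T in \<open>auto simp: J_def\<close>)
    moreover have "((\<lambda>x. 2 * t - x) has_vector_derivative - 1) (at x within {a..t - e})"
      by (auto intro!: derivative_eq_intros)
    ultimately have "((F \<circ> (\<lambda>x. 2 * t - x)) has_vector_derivative - 1 *\<^sub>R f (2 * t - x)) (at x within {a..t - e})"
      by (intro vector_diff_chain_within)
    then show "((\<lambda>x. F (2 * t - x)) has_vector_derivative f x) (at x within {a..t - e})"
      using odd[of "t - x"] by (simp add: o_def)
  qed (use e in auto)
  ultimately show ?thesis
    using that[of "F (t + e) - F (2 * t - a)"] by (simp add: Fb)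
qed

text \<open>The two integrals cancel exactly for each admissible \<open>e\<close>, so the cosine
  part needs no singular correction.\<close>

lemma kern_cos_punctured_integral:
  fixes a b t T :: real and m :: int
  assumes T: "T = b - a" and e: "0 < e" "e \<le> t - a" "e \<le> b - t"
  defines "f \<equiv> \<lambda>x. kern_cos m (pi * (x - t) / T)"
  obtains A where "(f has_integral A) {a..t - e}" "(f has_integral - A) {t + e..b}"
proof -
  have cont: "isCont f x" if "0 < \<bar>x - t\<bar>" "\<bar>x - t\<bar> < T" for x
  proof -
    have "sin (pi * (x - t) / T) \<noteq> 0" "T \<noteq> 0" using that by (intro phase_sin_nonzero; simp) (use that in simp)
    then show ?thesis unfolding f_def by (intro continuous_intros) auto
  qed
  have odd: "f (t - y) = - f (t + y)" for y by (simp add: f_def)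
  have per: "f (x + T) = f x" for x
  proof -
    have "T \<noteq> 0" using T e by simp
    then have ph: "pi * (x + T - t) / T = pi * (x - t) / T + pi" by (simp add: field_simps)
    have "cos (2 * real_of_int m * (pi * (x - t) / T + pi)) = cos (2 * real_of_int m * (pi * (x - t) / T))"
      using cos_int_2pin[of m] sin_int_2pin[of m] by (simp add: cos_add algebra_simps)
    then show ?thesis unfolding f_def ph by simp
  qed
  obtain A where "(f has_integral A) {a..t - e}" "(f has_integral - A) {t + e..b}"
    by (rule odd_periodic_punctured_integral[where f = f, OF e T cont odd per])
  then show ?thesis by (rule that)
qed

section \<open>Complex exponentials: derivative corrections and the finite part\<close>

lemma expo_shift:
  assumes "T \<noteq> 0"
  shows "expo T m x = expo T m t * cis (2 * real_of_int m * (pi * (x - t) / T))"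
proof -
  have "2 * real_of_int m * pi * x / T
      = 2 * real_of_int m * pi * t / T + 2 * real_of_int m * (pi * (x - t) / T)"
    using assms by (simp add: field_simps)
  then show ?thesis
    unfolding expo_def cis_conv_exp by (simp only: of_real_add distrib_left exp_add)
qed

lemma kern_times_expo:
  assumes "T \<noteq> 0"
  shows "of_real (kern T t x) * expo T m x
    = expo T m t * (of_real (kern_cos m (pi * (x - t) / T)) + \<i> * of_real (kern_sin m (pi * (x - t) / T)))"
proof -
  have "of_real (kern T t x) * cis (2 * real_of_int m * (pi * (x - t) / T))
      = of_real (kern_cos m (pi * (x - t) / T)) + \<i> * of_real (kern_sin m (pi * (x - t) / T))"
    by (simp add: complex_eq_iff kern_def)
  then show ?thesis
    unfolding expo_shift[OF assms, of m x t] by (simp only: mult.left_commute)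
qed

lemma expo_has_fps_expansion:
  "(\<lambda>w. \<Sum>m\<in>M. c m * expo T m t * exp (2 * \<i> * of_real (pi / T) * of_int m * w)) has_fps_expansion
    (\<Sum>m\<in>M. fps_const (c m * expo T m t) * fps_exp (2 * \<i> * of_real (pi / T) * of_int m))"
  by (intro has_fps_expansion_sum has_fps_expansion_mult has_fps_expansion_const has_fps_expansion_exp)

text \<open>With \<open>q = pi / T\<close>, the coefficients of the exponential at orders 1 and 3
  are \<open>2 \<i> m q\<close> and \<open>(2 \<i> m q)^3 / 6\<close>, to be divided by
  \<open>q^3\<close>.\<close>

lemma nth_vderiv_cubed_reg_expo:
  fixes c :: "int \<Rightarrow> complex" and t T :: real and M :: "int set"
  assumes T: "T \<noteq> 0"
  defines "f \<equiv> \<lambda>x. of_real (kern T t x) * (\<Sum>m\<in>M. c m * expo T m x)"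
  shows "nth_vderiv 1 (cubed_reg t f) t
      = (\<Sum>m\<in>M. c m * expo T m t * (2 * \<i> * of_int m * of_real ((T / pi) ^ 2)))"
    and "nth_vderiv 3 (cubed_reg t f) t = (\<Sum>m\<in>M. c m * expo T m t * (- 8 * \<i> * of_int m ^ 3))"
proof -
  let ?E = "\<Sum>m\<in>M. fps_const (c m * expo T m t) * fps_exp (2 * \<i> * of_real (pi / T) * of_int m)"
  let ?U = "\<lambda>w. \<Sum>m\<in>M. c m * expo T m t * exp (2 * \<i> * of_real (pi / T) * of_int m * w)"
  have u: "(\<Sum>m\<in>M. c m * expo T m x) = ?U (of_real (x - t))" for x
  proof (intro sum.cong refl)
    fix m
    have "\<i> * of_real (2 * real_of_int m * (pi * (x - t) / T))
        = 2 * \<i> * of_real (pi / T) * of_int m * of_real (x - t)"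
      by simp
    then show "c m * expo T m x
        = c m * expo T m t * exp (2 * \<i> * of_real (pi / T) * of_int m * of_real (x - t))"
      unfolding expo_shift[OF T, of m x t] cis_conv_exp by (simp only: mult.assoc)
  qed
  have "nth_vderiv 1 (cubed_reg t f) t = fps_nth ?E 1 / of_real (pi / T) ^ 3"
    "nth_vderiv 3 (cubed_reg t f) t = 6 * fps_nth ?E 3 / of_real (pi / T) ^ 3"
    unfolding f_def
    by (rule nth_vderiv_cubed_reg[OF T expo_has_fps_expansion u])+
  moreover have "fps_nth ?E 1 / of_real (pi / T) ^ 3
      = (\<Sum>m\<in>M. c m * expo T m t * (2 * \<i> * of_int m * of_real ((T / pi) ^ 2)))"
    unfolding fps_sum_nth sum_divide_distrib using T
    by (intro sum.cong refl) (simp add: power2_eq_square power3_eq_cube)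
  moreover have "6 * fps_nth ?E 3 / of_real (pi / T) ^ 3
      = (\<Sum>m\<in>M. c m * expo T m t * (- 8 * \<i> * of_int m ^ 3))"
    unfolding fps_sum_nth sum_distrib_left sum_divide_distrib using T
    by (intro sum.cong refl) (simp add: power3_eq_cube fact_numeral)
  ultimately show "nth_vderiv 1 (cubed_reg t f) t
      = (\<Sum>m\<in>M. c m * expo T m t * (2 * \<i> * of_int m * of_real ((T / pi) ^ 2)))"
    "nth_vderiv 3 (cubed_reg t f) t = (\<Sum>m\<in>M. c m * expo T m t * (- 8 * \<i> * of_int m ^ 3))"
    by simp_all
qed

lemma kern_expo_finite_part:
  fixes a b t T :: real and m :: int
  assumes t: "a < t" "t < b" and T: "T = b - a"
  defines "f \<equiv> \<lambda>x. of_real (kern T t x) * expo T m x"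
  shows "\<exists>A B. (\<forall>\<^sub>F e in at_right 0. (f has_integral A e) {a..t - e} \<and> (f has_integral B e) {t + e..b})
    \<and> ((\<lambda>e. A e + B e - 2 * (expo T m t * (2 * \<i> * of_int m * of_real ((T / pi) ^ 2))) / of_real e)
        \<longlongrightarrow> expo T m t * (- 2 * \<i> * of_int m * of_int \<bar>m\<bar> * of_real T)) (at_right 0)"
proof -
  have T0: "T \<noteq> 0" using t T by simp
  define C where "C x = kern_cos m (pi * (x - t) / T)" for x
  define S where "S x = kern_sin m (pi * (x - t) / T)" for x
  define E where "E = expo T m t"
  have f: "f = (\<lambda>x. E * (of_real (C x) + \<i> * of_real (S x)))"
    unfolding f_def C_def S_def E_def kern_times_expo[OF T0, of t] ..
  obtain A B where AB:
    "\<forall>\<^sub>F e in at_right 0. (S has_integral A e) {a..t - e} \<and> (S has_integral B e) {t + e..b}"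
    "((\<lambda>e. A e + B e - 4 * real_of_int m * (T / pi) ^ 2 / e)
        \<longlongrightarrow> - 2 * real_of_int m * \<bar>real_of_int m\<bar> * T) (at_right 0)"
    using kern_sin_finite_part[OF t T, of m] unfolding S_def by blast
  \<comment> \<open>The cosine part contributes \<open>D e\<close> on the left and
    \<open>- D e\<close> on the right, so it drops out of the limit.\<close>
  define D where "D e = integral {a..t - e} C" for e
  have "0 < min (t - a) (b - t)" using t by simp
  then have "\<forall>\<^sub>F e in at_right 0. e \<in> {0<..<min (t - a) (b - t)}"
    by (rule eventually_at_right_real)
  then have "\<forall>\<^sub>F e in at_right 0. (C has_integral D e) {a..t - e} \<and> (C has_integral - D e) {t + e..b}"
  proof eventually_elim
    case (elim e)
    obtain A where "(C has_integral A) {a..t - e}" "(C has_integral - A) {t + e..b}"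
      unfolding C_def by (rule kern_cos_punctured_integral[OF T, of e t m]) (use elim in auto)
    then show ?case by (auto simp: D_def integral_unique)
  qed
  with AB(1) have ev: "\<forall>\<^sub>F e in at_right 0.
      (f has_integral E * (of_real (D e) + \<i> * of_real (A e))) {a..t - e} \<and>
      (f has_integral E * (of_real (- D e) + \<i> * of_real (B e))) {t + e..b}"
    by eventually_elim
      (unfold f, intro conjI has_integral_mult_right has_integral_add has_integral_of_real; blast)
  have "((\<lambda>e. E * (\<i> * of_real (A e + B e - 4 * real_of_int m * (T / pi) ^ 2 / e)))
      \<longlongrightarrow> E * (\<i> * of_real (- 2 * real_of_int m * \<bar>real_of_int m\<bar> * T))) (at_right 0)"
    by (intro tendsto_intros AB(2))
  moreover have "complex_of_real \<bar>real_of_int m\<bar> = of_int \<bar>m\<bar>"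
    by (metis of_int_abs of_real_of_int_eq)
  ultimately have lim: "((\<lambda>e. E * (of_real (D e) + \<i> * of_real (A e)) + E * (of_real (- D e) + \<i> * of_real (B e))
        - 2 * (E * (2 * \<i> * of_int m * of_real ((T / pi) ^ 2))) / of_real e)
      \<longlongrightarrow> E * (- 2 * \<i> * of_int m * of_int \<bar>m\<bar> * of_real T)) (at_right 0)"
    by (simp add: algebra_simps)
  show ?thesis unfolding E_def[symmetric]
    by (rule exI[of _ "\<lambda>e. E * (of_real (D e) + \<i> * of_real (A e))"],
        rule exI[of _ "\<lambda>e. E * (of_real (- D e) + \<i> * of_real (B e))"])
      (rule conjI[OF ev lim])
qed

lemma hadamard_fp_expo:
  fixes a b t T :: real and c :: "int \<Rightarrow> complex"
  assumes t: "a < t" "t < b" and T: "T = b - a" and M: "finite M"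
  shows "has_hadamard_fp a b t (\<lambda>x. of_real (kern T t x) * (\<Sum>m\<in>M. c m * expo T m x))
    (\<Sum>m\<in>M. c m * expo T m t * (- 2 * \<i> * of_int m * of_int \<bar>m\<bar> * of_real T))"
    (is "has_hadamard_fp a b t ?f ?I")
proof -
  have T0: "T \<noteq> 0" using t T by simp
  define g where "g m x = of_real (kern T t x) * expo T m x" for m x
  define d where "d m = expo T m t * (2 * \<i> * of_int m * of_real ((T / pi) ^ 2))" for m
  define I where "I m = expo T m t * (- 2 * \<i> * of_int m * of_int \<bar>m\<bar> * of_real T)" for m
  define P where "P m A B \<longleftrightarrow>
    (\<forall>\<^sub>F e in at_right 0. (g m has_integral A e) {a..t - e} \<and> (g m has_integral B e) {t + e..b})
    \<and> ((\<lambda>e. A e + B e - 2 * d m / of_real e) \<longlongrightarrow> I m) (at_right 0)" for m A B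
  \<comment> \<open>\<open>P\<close> packages the claim for a single \<open>m\<close>, so that the
    witnesses can be chosen as functions of \<open>m\<close>.\<close>
  have "\<forall>m. \<exists>A B. P m A B"
    unfolding P_def g_def d_def I_def by (rule allI, rule kern_expo_finite_part[OF t T])
  then obtain A B where "P m (A m) (B m)" for m by metis
  then have ev: "\<forall>\<^sub>F e in at_right 0. (g m has_integral A m e) {a..t - e} \<and> (g m has_integral B m e) {t + e..b}"
    and lim: "((\<lambda>e. A m e + B m e - 2 * d m / of_real e) \<longlongrightarrow> I m) (at_right 0)" for m
    unfolding P_def by (rule conjunct1, rule conjunct2)
  have f: "?f = (\<lambda>x. \<Sum>m\<in>M. c m * g m x)"
    unfolding g_def sum_distrib_left by (simp add: algebra_simps)
  have d: "nth_vderiv 1 (cubed_reg t ?f) t = (\<Sum>m\<in>M. c m * d m)"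
    unfolding nth_vderiv_cubed_reg_expo(1)[OF T0] d_def by (simp only: mult.assoc)
  have "\<forall>\<^sub>F e in at_right 0. \<forall>m\<in>M.
      (g m has_integral A m e) {a..t - e} \<and> (g m has_integral B m e) {t + e..b}"
    \<comment> \<open>Finiteness of \<open>M\<close> gives one range of small \<open>e\<close> that
      serves all \<open>m\<close>.\<close>
    using M ev by (simp add: eventually_ball_finite)
  then have int: "\<forall>\<^sub>F e in at_right 0. (?f has_integral (\<Sum>m\<in>M. c m * A m e)) {a..t - e} \<and>
      (?f has_integral (\<Sum>m\<in>M. c m * B m e)) {t + e..b}"
    by eventually_elim (unfold f, use M in \<open>auto intro!: has_integral_sum has_integral_mult_right\<close>)
  have "((\<lambda>e. \<Sum>m\<in>M. c m * (A m e + B m e - 2 * d m / of_real e)) \<longlongrightarrow> (\<Sum>m\<in>M. c m * I m)) (at_right 0)"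
    by (intro tendsto_intros lim)
  then have "((\<lambda>e. integral {a..t - e} ?f + integral {t + e..b} ?f
      - 2 * nth_vderiv 1 (cubed_reg t ?f) t / of_real e) \<longlongrightarrow> (\<Sum>m\<in>M. c m * I m)) (at_right 0)"
  proof (rule Lim_transform_eventually)
    show "\<forall>\<^sub>F e in at_right 0. (\<Sum>m\<in>M. c m * (A m e + B m e - 2 * d m / of_real e))
        = integral {a..t - e} ?f + integral {t + e..b} ?f
          - 2 * nth_vderiv 1 (cubed_reg t ?f) t / of_real e"
      using int
    proof eventually_elim
      case (elim e)
      then have "integral {a..t - e} ?f = (\<Sum>m\<in>M. c m * A m e)"
        "integral {t + e..b} ?f = (\<Sum>m\<in>M. c m * B m e)"
        by (simp_all add: integral_unique)
      then show ?case
        unfolding d by (simp add: sum.distrib sum_subtractf sum_distrib_left sum_divide_distrib algebra_simps)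
    qed
  qed
  moreover have "(\<Sum>m\<in>M. c m * I m) = ?I" unfolding I_def by (simp only: mult.assoc)
  moreover have "\<forall>\<^sub>F e in at_right 0. ?f integrable_on {a..t - e} \<and> ?f integrable_on {t + e..b}"
    using int by eventually_elim (auto simp: has_integral_integrable)
  ultimately show ?thesis unfolding has_hadamard_fp_def by simp
qed

section \<open>Evaluation of the quadrature rules\<close>

lemma sum_kern_expo_trapezoid:
  fixes c :: "int \<Rightarrow> complex"
  assumes T: "T \<noteq> 0" and M: "\<forall>m\<in>M. \<bar>m\<bar> < int n"
  shows "(\<Sum>j=1..n-1. of_real (kern T t (t + real j * (T / real n)))
        * (\<Sum>m\<in>M. c m * expo T m (t + real j * (T / real n))))
    = (\<Sum>m\<in>M. c m * expo T m t * (\<i> * of_real (2 * real_of_int m * (real n ^ 2 - 1) / 3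
        + (4 * real_of_int m ^ 3 + 2 * real_of_int m) / 3
        - 2 * real_of_int m * \<bar>real_of_int m\<bar> * real n)))" (is "?L = ?R")
proof -
  let ?x = "\<lambda>j. real j * (pi / real n)"
  have ph: "pi * (t + real j * (T / real n) - t) / T = ?x j" for j
    using T by simp
  have "?L = (\<Sum>m\<in>M. \<Sum>j=1..n-1. c m * (of_real (kern T t (t + real j * (T / real n)))
        * expo T m (t + real j * (T / real n))))"
    unfolding sum_distrib_left by (subst sum.swap) (simp add: algebra_simps)
  also have "\<dots> = (\<Sum>m\<in>M. c m * expo T m t *
      (of_real (\<Sum>j=1..n-1. kern_cos m (?x j)) + \<i> * of_real (\<Sum>j=1..n-1. kern_sin m (?x j))))"
    unfolding kern_times_expo[OF T, of t] ph of_real_sum sum_distrib_left sum.distrib[symmetric]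
    by (simp only: mult.assoc)
  also have "\<dots> = ?R"
    by (intro sum.cong refl)
      (simp only: sum_kern_cos_trapezoid sum_kern_sin_trapezoid[OF M[rule_format]] of_real_0 add_0)
  finally show ?thesis .
qed

lemma sum_kern_expo_midpoint:
  fixes c :: "int \<Rightarrow> complex" and t T :: real and M :: "int set"
  assumes T: "T \<noteq> 0" and n: "0 < n" and M: "\<forall>m\<in>M. \<bar>m\<bar> < int n"
  defines "x \<equiv> \<lambda>j. t + real j * (T / real n) - T / real n / 2"
  shows "(\<Sum>j=1..n. of_real (kern T t (x j)) * (\<Sum>m\<in>M. c m * expo T m (x j)))
    = (\<Sum>m\<in>M. c m * expo T m t * (\<i> * of_real (2 * real_of_int m * real n ^ 2
        - 2 * real_of_int m * \<bar>real_of_int m\<bar> * real n)))" (is "?L = ?R")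
proof -
  let ?y = "\<lambda>j. pi / (2 * real n) + real j * (pi / real n)"
  \<comment> \<open>The rule counts nodes from 1, the real midpoint sums from 0; hence the shift by
    \<open>Suc\<close>.\<close>
  have ph: "pi * (x (Suc j) - t) / T = ?y j" for j
    using T n by (simp add: x_def field_simps)
  have "?L = (\<Sum>j<n. of_real (kern T t (x (Suc j))) * (\<Sum>m\<in>M. c m * expo T m (x (Suc j))))"
    by (rule sum.reindex_bij_witness[of _ Suc "\<lambda>j. j - 1"]) auto
  also have "\<dots> = (\<Sum>m\<in>M. \<Sum>j<n. c m * (of_real (kern T t (x (Suc j))) * expo T m (x (Suc j))))"
    unfolding sum_distrib_left by (subst sum.swap) (simp add: algebra_simps)
  also have "\<dots> = (\<Sum>m\<in>M. c m * expo T m t *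
      (of_real (\<Sum>j<n. kern_cos m (?y j)) + \<i> * of_real (\<Sum>j<n. kern_sin m (?y j))))"
    unfolding kern_times_expo[OF T, of t] ph of_real_sum sum_distrib_left sum.distrib[symmetric]
    by (simp only: mult.assoc)
  also have "\<dots> = ?R"
    by (intro sum.cong refl)
      (simp only: sum_kern_cos_midpoint sum_kern_sin_midpoint[OF M[rule_format]] of_real_0 add_0)
  finally show ?thesis .
qed

text \<open>All rules reduce to the value of the finite part. In \<open>quad0\<close> the
  first-derivative term removes the part growing with \<open>n\<close> and the third-derivative term
  removes the \<open>m^3 / n\<close> part. In \<open>quad1\<close> the first-derivative term
  suffices. In \<open>quad2\<close> the part linear in \<open>n\<close> cancels between the midpoint
  sums with \<open>n\<close> and \<open>2 n\<close> nodes.\<close>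

lemma quad_expo:
  fixes c :: "int \<Rightarrow> complex"
  assumes T: "T \<noteq> 0" and n: "0 < n" and M: "\<forall>m\<in>M. \<bar>m\<bar> < int n"
    and Q: "Q \<in> {quad0, quad1, quad2}"
  shows "Q T t n (\<lambda>x. of_real (kern T t x) * (\<Sum>m\<in>M. c m * expo T m x))
    = (\<Sum>m\<in>M. c m * expo T m t * (- 2 * \<i> * of_int m * of_int \<bar>m\<bar> * of_real T))"
    (is "Q T t n ?f = ?I")
proof -
  have M2: "\<forall>m\<in>M. \<bar>m\<bar> < int (2 * n)" using M by force
  have abs: "complex_of_real \<bar>real_of_int m\<bar> = of_int \<bar>m\<bar>" for m
    by (metis of_int_abs of_real_of_int_eq)
  have 0: "quad0 T t n ?f = ?I"
    unfolding quad0_def Let_def sum_kern_expo_trapezoid[OF T M] nth_vderiv_cubed_reg_expo[OF T]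
    unfolding sum_distrib_left sum_distrib_right sum_divide_distrib sum_subtractf[symmetric] sum.distrib[symmetric]
    using T n by (intro sum.cong refl) (simp add: abs field_simps power2_eq_square power3_eq_cube)
  have 1: "quad1 T t n ?f = ?I"
    unfolding quad1_def Let_def sum_kern_expo_midpoint[OF T n M] nth_vderiv_cubed_reg_expo[OF T]
    unfolding sum_distrib_left sum_distrib_right sum_divide_distrib sum_subtractf[symmetric] sum.distrib[symmetric]
    using T n by (intro sum.cong refl) (simp add: abs field_simps power2_eq_square)
  have n2: "0 < 2 * n" using n by simp
  \<comment> \<open>The second sum of \<open>quad2\<close> is the midpoint sum with
    \<open>2 * n\<close> nodes.\<close>
  have x: "t + real j * (T / real n) / 2 - T / real n / 4
      = t + real j * (T / real (2 * n)) - T / real (2 * n) / 2" for j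
    by simp
  have 2: "quad2 T t n ?f = ?I"
    unfolding quad2_def Let_def x sum_kern_expo_midpoint[OF T n M] sum_kern_expo_midpoint[OF T n2 M2]
    unfolding sum_distrib_left sum_subtractf[symmetric]
    using T n by (intro sum.cong refl) (simp add: abs field_simps power2_eq_square)
  show ?thesis using 0 1 2 Q by blast
qed

theorem theorem2p4:
  fixes a b t T :: real and n :: nat
    and Q :: "real \<Rightarrow> real \<Rightarrow> nat \<Rightarrow> (real \<Rightarrow> complex) \<Rightarrow> complex"
  assumes "a < b" and "T = b - a" and "t \<in> {a<..<b}" and "n > 0"
    and "Q \<in> {quad0, quad1, quad2}"
  shows "(\<forall>m \<in> {- (int n - 1)..int n - 1}.
            let f = (\<lambda>x. of_real (kern T t x) * expo T m x)
            in has_hadamard_fp a b t f (Q T t n f)) \<and>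
         (\<forall>c :: int \<Rightarrow> complex.
            let f = (\<lambda>x. of_real (kern T t x) *
                         (\<Sum>m = - (int n - 1)..int n - 1. c m * expo T m x))
            in has_hadamard_fp a b t f (Q T t n f))"
proof -
  have T0: "T \<noteq> 0" and t: "a < t" "t < b" using assms by auto
  \<comment> \<open>Stated for any subset \<open>M\<close> of the index range, so that
    \<open>M = {m}\<close> with coefficient 1 yields the single functions and the full range yields
    the sums.\<close>
  have *: "has_hadamard_fp a b t (\<lambda>x. of_real (kern T t x) * (\<Sum>m\<in>M. c m * expo T m x))
      (Q T t n (\<lambda>x. of_real (kern T t x) * (\<Sum>m\<in>M. c m * expo T m x)))"
    if "M \<subseteq> {- (int n - 1)..int n - 1}" for M c
    using hadamard_fp_expo[OF t assms(2), of M c] that finite_subset[OF that]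
    by (subst quad_expo[OF T0 assms(4) _ assms(5)]) (force, simp add: t)
  have "has_hadamard_fp a b t (\<lambda>x. of_real (kern T t x) * expo T m x)
      (Q T t n (\<lambda>x. of_real (kern T t x) * expo T m x))"
    if "m \<in> {- (int n - 1)..int n - 1}" for m
    using *[of "{m}" "\<lambda>_. 1"] that by simp
  with * show ?thesis by (simp add: Let_def)
qed

end
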